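(* Let $(X,T)$ be a t.d.s. Then the following conditions are equivalent: (1) $\mathrm{Ind}_{ap}(X,T)=X\times X$. (2) $(X,T)$ is $\Delta$-transitive. (3) The trivial (one-point) system is a $d$-step topological characteristic factor of $(X,T)$ for all $d\ge2$. (4) $\Delta\text{-}Trans(X,T)$ is a dense $G_\delta$ set in $2^X$.
   Context: A t.d.s. $(X,T)$ is a compact metric space $X$ with a homeomorphism $T$. $2^X$ is the space of non-empty closed subsets of $X$ with the Hausdorff topology. $\mathbb{N}=\{1,2,\dots\}$. For $d\in\mathbb{N}$, a pair $(x_1,x_2)\in X\times X$ is an $\mathrm{Ind}_{ap}$-pair of order $d$ if for all neighborhoods $U_1,U_2$ of $x_1,x_2$ there is $n\in\mathbb{Z}\setminus\{0\}$ such that for every $(t_1,\dots,t_d)\in\{1,2\}^d$, $T^{-n}U_{t_1}\cap T^{-2n}U_{t_2}\cap\cdots\cap T^{-dn}U_{t_d}\neq\emptyset$. $\mathrm{Ind}_{ap}(X,T)$ is the set of pairs that are $\mathrm{Ind}_{ap}$-pairs of order $d$ for every $d\in\mathbb{N}$. For subsets $U_0,\dots,U_d$ of $X$ let $N(U_0,U_1,\dots,U_d)=\{n\in\mathbb{N}:\bigcap_{i=0}^dT^{-in}U_i\neq\emptyset\}$. $(X,T)$ is $\Delta$-transitive of order $d$ if $N(U_0,\dots,U_d)\neq\emptyset$ for all non-empty open $U_0,\dots,U_d$, and $\Delta$-transitive if this holds for every $d\in\mathbb{N}$. A closed set $A\subseteq X$ is a $\Delta$-transitive set of order $d$ if $N(U_0\cap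 A,U_1,\dots,U_d)\neq\emptyset$ for all non-empty open $U_0,\dots,U_d$ of $X$ intersecting $A$, and a $\Delta$-transitive set if this holds for every $d\in\mathbb{N}$. $\Delta\text{-}Trans(X,T)\subseteq 2^X$ is the set of all $\Delta$-transitive sets. Let $\pi:(X,T)\to(Y,T)$ be a factor map (continuous equivariant surjection) and $\tau_d=T\times T^2\times\cdots\times T^d$ on $X^d$. $(Y,T)$ is a $d$-step topological characteristic factor of $(X,T)$ if there is a dense $G_\delta$ set $X_0\subseteq X$ such that for every $x\in X_0$ the orbit closure $L_x=\overline{\{\tau_d^n(x,\dots,x):n\in\mathbb{Z}\}}\subseteq X^d$ is saturated for $\pi\times\cdots\times\pi$, i.e. if $(x_1,\dots,x_d)\in L_x$ and $\pi(x_i)=\pi(x_i')$ for all $i$ then $(x_1',\dots,x_d')\in L_x$. *)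

theory Defs
  imports "HOL-Analysis.Analysis"
begin

text \<open>A topological dynamical system is carried by a non-empty compact subset \<open>X\<close> of a metric
  space; the values of \<open>T\<close> outside \<open>X\<close> are irrelevant. All topological notions are relative
  to \<open>X\<close>, i.e. taken in \<open>top_of_set X\<close>.\<close>

definition tds :: "'a::metric_space set \<Rightarrow> ('a \<Rightarrow> 'a) \<Rightarrow> bool" where
  "tds X T \<longleftrightarrow> compact X \<and> X \<noteq> {} \<and> (\<exists>T'. homeomorphism X X T T')"

text \<open>The integer iterate \<open>T\<^sup>n\<close> of a bijection \<open>T\<close> of \<open>X\<close>.\<close>

definition ziter :: "'a set \<Rightarrow> ('a \<Rightarrow> 'a) \<Rightarrow> int \<Rightarrow> 'a \<Rightarrow> 'a" where
  "ziter X T n = (if 0 \<le> n then T ^^ nat n else inv_into X T ^^ nat (- n))"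

text \<open>The set \<open>T\<^sup>-\<^sup>n U\<close>.\<close>

definition zpreimage :: "'a set \<Rightarrow> ('a \<Rightarrow> 'a) \<Rightarrow> int \<Rightarrow> 'a set \<Rightarrow> 'a set" where
  "zpreimage X T n U = {x \<in> X. ziter X T n x \<in> U}"


subsection \<open>Independence pairs along arithmetic progressions\<close>

definition ind_ap_pair :: "'a::metric_space set \<Rightarrow> ('a \<Rightarrow> 'a) \<Rightarrow> nat \<Rightarrow> 'a \<times> 'a \<Rightarrow> bool" where
  "ind_ap_pair X T d p \<longleftrightarrow>
     p \<in> X \<times> X \<and>
     (\<forall>U :: nat \<Rightarrow> 'a set.
        U 1 \<subseteq> X \<and> fst p \<in> top_of_set X interior_of U 1 \<and>
        U 2 \<subseteq> X \<and> snd p \<in> top_of_set X interior_of U 2 \<longrightarrow>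
        (\<exists>n::int. n \<noteq> 0 \<and>
           (\<forall>t \<in> {1..d} \<rightarrow> {1, 2}. (\<Inter>i\<in>{1..d}. zpreimage X T (int i * n) (U (t i))) \<noteq> {})))"

definition Ind_ap :: "'a::metric_space set \<Rightarrow> ('a \<Rightarrow> 'a) \<Rightarrow> ('a \<times> 'a) set" where
  "Ind_ap X T = {p \<in> X \<times> X. \<forall>d\<ge>1. ind_ap_pair X T d p}"


subsection \<open>\<open>\<Delta>\<close>-transitivity\<close>

text \<open>\<open>return_times X T d U\<close> is \<open>N(U\<^sub>0, \<dots>, U\<^sub>d)\<close>; only \<open>U 0, \<dots>, U d\<close> matter.\<close>

definition return_times :: "'a set \<Rightarrow> ('a \<Rightarrow> 'a) \<Rightarrow> nat \<Rightarrow> (nat \<Rightarrow> 'a set) \<Rightarrow> nat set" where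
  "return_times X T d U = {n. 1 \<le> n \<and> (\<Inter>i\<in>{0..d}. zpreimage X T (int (i * n)) (U i)) \<noteq> {}}"

definition delta_transitive_of_order :: "'a::metric_space set \<Rightarrow> ('a \<Rightarrow> 'a) \<Rightarrow> nat \<Rightarrow> bool" where
  "delta_transitive_of_order X T d \<longleftrightarrow>
     (\<forall>U. (\<forall>i\<in>{0..d}. openin (top_of_set X) (U i) \<and> U i \<noteq> {}) \<longrightarrow> return_times X T d U \<noteq> {})"

definition delta_transitive :: "'a::metric_space set \<Rightarrow> ('a \<Rightarrow> 'a) \<Rightarrow> bool" where
  "delta_transitive X T \<longleftrightarrow> (\<forall>d\<ge>1. delta_transitive_of_order X T d)"

definition delta_transitive_set_of_order ::
    "'a::metric_space set \<Rightarrow> ('a \<Rightarrow> 'a) \<Rightarrow> nat \<Rightarrow> 'a set \<Rightarrow> bool" where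
  "delta_transitive_set_of_order X T d A \<longleftrightarrow>
     closedin (top_of_set X) A \<and>
     (\<forall>U. (\<forall>i\<in>{0..d}. openin (top_of_set X) (U i) \<and> U i \<inter> A \<noteq> {}) \<longrightarrow>
          return_times X T d (U(0 := U 0 \<inter> A)) \<noteq> {})"

definition delta_transitive_set :: "'a::metric_space set \<Rightarrow> ('a \<Rightarrow> 'a) \<Rightarrow> 'a set \<Rightarrow> bool" where
  "delta_transitive_set X T A \<longleftrightarrow> (\<forall>d\<ge>1. delta_transitive_set_of_order X T d A)"


subsection \<open>The hyperspace \<open>2\<^sup>X\<close>\<close>

definition hyperspace :: "'a::metric_space set \<Rightarrow> 'a set set" where
  "hyperspace X = {A. closedin (top_of_set X) A \<and> A \<noteq> {}}"

text \<open>The Hausdorff distance of non-empty bounded sets. It is set to \<open>0\<close> for other arguments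
  because the library locale \<open>Metric_space\<close> requires a function that is non-negative on the
  whole type.\<close>

definition hausdorff_dist :: "'a::metric_space set \<Rightarrow> 'a set \<Rightarrow> real" where
  "hausdorff_dist A B =
     (if A \<noteq> {} \<and> B \<noteq> {} \<and> bounded A \<and> bounded B
      then max (SUP a\<in>A. infdist a B) (SUP b\<in>B. infdist b A) else 0)"

definition hausdorff_topology :: "'a::metric_space set \<Rightarrow> 'a set topology" where
  "hausdorff_topology X = Metric_space.mtopology (hyperspace X) hausdorff_dist"

lemma bdd_above_infdist:
  assumes "bounded A" "B \<noteq> {}"
  shows "bdd_above ((\<lambda>a. infdist a B) ` A)"
proof -
  obtain b where b: "b \<in> B" using assms by blast
  obtain e where e: "\<And>a. a \<in> A \<Longrightarrow> dist b a \<le> e"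
    using assms(1) bounded_any_center by blast
  show ?thesis
    by (rule bdd_aboveI2[where M = e]) (metis b dist_commute e infdist_le2)
qed

lemma hausdorff_dist_less_eq_iff:
  assumes "A \<noteq> {}" "B \<noteq> {}" "bounded A" "bounded B"
  shows "hausdorff_dist A B \<le> r \<longleftrightarrow> (\<forall>a\<in>A. infdist a B \<le> r) \<and> (\<forall>b\<in>B. infdist b A \<le> r)"
  using assms by (simp add: hausdorff_dist_def cSUP_le_iff bdd_above_infdist)

lemma infdist_triangle_set:
  assumes "B \<noteq> {}" "\<And>b. b \<in> B \<Longrightarrow> infdist b C \<le> s"
  shows "infdist a C \<le> infdist a B + s"
proof -
  have "infdist a C - s \<le> dist a b" if "b \<in> B" for b
    using infdist_triangle[of a C b] assms(2)[OF that] by linarith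
  then have "infdist a C - s \<le> infdist a B"
    using assms(1) by (simp add: infdist_notempty cINF_greatest)
  then show ?thesis by linarith
qed

text \<open>On the hyperspace of a compact set, \<open>hausdorff_dist\<close> is a metric, so \<open>hausdorff_topology\<close>
  is the topology of a metric.\<close>

lemma Metric_space_hausdorff:
  assumes "compact X"
  shows "Metric_space (hyperspace X) hausdorff_dist"
proof
  show nonneg: "0 \<le> hausdorff_dist A B" for A B :: "'a set"
  proof (cases "A \<noteq> {} \<and> B \<noteq> {} \<and> bounded A \<and> bounded B")
    case True
    then obtain a where "a \<in> A" by blast
    have "infdist a B \<le> hausdorff_dist A B"
      using hausdorff_dist_less_eq_iff[of A B "hausdorff_dist A B"] True \<open>a \<in> A\<close> by auto
    then show ?thesis using infdist_nonneg[of a B] by linarith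
  qed (auto simp: hausdorff_dist_def)
  show "hausdorff_dist A B = hausdorff_dist B A" for A B :: "'a set"
    by (auto simp: hausdorff_dist_def max.commute)
  have H: "A \<noteq> {}" "bounded A" "closed A" if "A \<in> hyperspace X" for A
    using that assms closedin_compact[of X A]
    by (auto simp: hyperspace_def compact_imp_bounded compact_imp_closed)
  show "hausdorff_dist A B = 0 \<longleftrightarrow> A = B" if "A \<in> hyperspace X" "B \<in> hyperspace X" for A B
  proof -
    have "hausdorff_dist A B = 0 \<longleftrightarrow> hausdorff_dist A B \<le> 0"
      using nonneg[of A B] by linarith
    also have "\<dots> \<longleftrightarrow> (\<forall>a\<in>A. infdist a B = 0) \<and> (\<forall>b\<in>B. infdist b A = 0)"
    proof -
      have "infdist a C \<le> 0 \<longleftrightarrow> infdist a C = 0" for a and C :: "'a set"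
        using infdist_nonneg[of a C] by linarith
      then show ?thesis
        using hausdorff_dist_less_eq_iff[of A B 0] H[OF that(1)] H[OF that(2)] by simp
    qed
    also have "\<dots> \<longleftrightarrow> A \<subseteq> B \<and> B \<subseteq> A"
    proof -
      have "\<And>x. x \<in> A \<longleftrightarrow> infdist x A = 0" "\<And>x. x \<in> B \<longleftrightarrow> infdist x B = 0"
        using H[OF that(1)] H[OF that(2)] by (simp_all add: in_closed_iff_infdist_zero)
      then show ?thesis by blast
    qed
    finally show ?thesis by blast
  qed
  show "hausdorff_dist A C \<le> hausdorff_dist A B + hausdorff_dist B C"
    if "A \<in> hyperspace X" "B \<in> hyperspace X" "C \<in> hyperspace X" for A B C
  proof -
    note h = H[OF that(1)] H[OF that(2)] H[OF that(3)]
    have AB: "infdist a B \<le> hausdorff_dist A B" "infdist b A \<le> hausdorff_dist A B"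
      if "a \<in> A" "b \<in> B" for a b
      using hausdorff_dist_less_eq_iff[of A B "hausdorff_dist A B"] h that by auto
    have BC: "infdist b C \<le> hausdorff_dist B C" "infdist c B \<le> hausdorff_dist B C"
      if "b \<in> B" "c \<in> C" for b c
      using hausdorff_dist_less_eq_iff[of B C "hausdorff_dist B C"] h that by auto
    have "infdist a C \<le> hausdorff_dist A B + hausdorff_dist B C" if "a \<in> A" for a
    proof -
      have "infdist b C \<le> hausdorff_dist B C" if "b \<in> B" for b
        using BC(1)[OF that] h by auto
      then have "infdist a C \<le> infdist a B + hausdorff_dist B C"
        using infdist_triangle_set[of B C "hausdorff_dist B C" a] h by auto
      moreover have "infdist a B \<le> hausdorff_dist A B" using AB(1)[OF that] h by auto
      ultimately show ?thesis by linarith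
    qed
    moreover have "infdist c A \<le> hausdorff_dist A B + hausdorff_dist B C" if "c \<in> C" for c
    proof -
      have "infdist b A \<le> hausdorff_dist A B" if "b \<in> B" for b
        using AB(2)[OF _ that] h by auto
      then have "infdist c A \<le> infdist c B + hausdorff_dist A B"
        using infdist_triangle_set[of B A "hausdorff_dist A B" c] h by auto
      moreover have "infdist c B \<le> hausdorff_dist B C" using BC(2)[OF _ that] h by auto
      ultimately show ?thesis by linarith
    qed
    ultimately show ?thesis
      using hausdorff_dist_less_eq_iff[of A C] h by simp
  qed
qed

definition Delta_Trans :: "'a::metric_space set \<Rightarrow> ('a \<Rightarrow> 'a) \<Rightarrow> 'a set set" where
  "Delta_Trans X T = {A \<in> hyperspace X. delta_transitive_set X T A}"


subsection \<open>Topological characteristic factors\<close>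

definition factor_map ::
    "'a::metric_space set \<Rightarrow> ('a \<Rightarrow> 'a) \<Rightarrow> 'b::metric_space set \<Rightarrow> ('b \<Rightarrow> 'b) \<Rightarrow> ('a \<Rightarrow> 'b) \<Rightarrow> bool" where
  "factor_map X T Y S \<pi> \<longleftrightarrow>
     tds X T \<and> tds Y S \<and> continuous_on X \<pi> \<and> \<pi> ` X = Y \<and> (\<forall>x\<in>X. \<pi> (T x) = S (\<pi> x))"

text \<open>The power \<open>X\<^sup>d\<close> is the library's extensional product indexed by \<open>{1..d}\<close>, with the product
  topology.\<close>

abbreviation power_carrier :: "'a set \<Rightarrow> nat \<Rightarrow> (nat \<Rightarrow> 'a) set" where
  "power_carrier X d \<equiv> {1..d} \<rightarrow>\<^sub>E X"

abbreviation power_topology :: "'a::metric_space set \<Rightarrow> nat \<Rightarrow> (nat \<Rightarrow> 'a) topology" where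
  "power_topology X d \<equiv> product_topology (\<lambda>i. top_of_set X) {1..d}"

definition tau :: "('a \<Rightarrow> 'a) \<Rightarrow> nat \<Rightarrow> (nat \<Rightarrow> 'a) \<Rightarrow> (nat \<Rightarrow> 'a)" where
  "tau T d p = (\<lambda>i\<in>{1..d}. (T ^^ i) (p i))"

definition diagonal_orbit_closure ::
    "'a::metric_space set \<Rightarrow> ('a \<Rightarrow> 'a) \<Rightarrow> nat \<Rightarrow> 'a \<Rightarrow> (nat \<Rightarrow> 'a) set" where
  "diagonal_orbit_closure X T d x =
     power_topology X d closure_of
       (range (\<lambda>n::int. ziter (power_carrier X d) (tau T d) n (\<lambda>i\<in>{1..d}. x)))"

definition saturated ::
    "'a set \<Rightarrow> ('a \<Rightarrow> 'b) \<Rightarrow> nat \<Rightarrow> (nat \<Rightarrow> 'a) set \<Rightarrow> bool" where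
  "saturated X \<pi> d L \<longleftrightarrow>
     (\<forall>p\<in>L. \<forall>p'\<in>power_carrier X d. (\<forall>i\<in>{1..d}. \<pi> (p i) = \<pi> (p' i)) \<longrightarrow> p' \<in> L)"

definition top_characteristic_factor ::
    "nat \<Rightarrow> 'a::metric_space set \<Rightarrow> ('a \<Rightarrow> 'a) \<Rightarrow> 'b::metric_space set \<Rightarrow> ('b \<Rightarrow> 'b) \<Rightarrow> ('a \<Rightarrow> 'b) \<Rightarrow> bool" where
  "top_characteristic_factor d X T Y S \<pi> \<longleftrightarrow>
     factor_map X T Y S \<pi> \<and>
     (\<exists>X\<^sub>0. gdelta_in (top_of_set X) X\<^sub>0 \<and> top_of_set X closure_of X\<^sub>0 = X \<and>
        (\<forall>x\<in>X\<^sub>0. saturated X \<pi> d (diagonal_orbit_closure X T d x)))"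

text \<open>The one-point system, realised on the set \<open>{0}\<close> of reals (the type \<open>unit\<close> is not an instance
  of \<open>metric_space\<close>); its only factor map is constant.\<close>

definition trivial_top_characteristic_factor ::
    "nat \<Rightarrow> 'a::metric_space set \<Rightarrow> ('a \<Rightarrow> 'a) \<Rightarrow> bool" where
  "trivial_top_characteristic_factor d X T \<longleftrightarrow>
     top_characteristic_factor d X T {0::real} id (\<lambda>_. 0)"

end

(* Independence of a pair of sets V, W along progressions of any length allows one to extend a common
   return time s of U_0, ..., U_d to U_(d+1): put V = {x. T^(is) x in U_i for i <= d} and
   W = {x. T^((d+1)s) x in U_(d+1)}, and realise the word V ... V W with difference n; then n + s is
   a return time of U_0, ..., U_(d+1). Conversely, one long progression whose targets spell out all
   words over {1, 2} of length d gives independence, each word being read off a translate of the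
   same progression. By Baire's theorem Delta-transitivity yields
   a residual set of points x for which (T^n x, ..., T^(dn) x), n >= 1, is dense in X^d for every d;
   such points make the trivial factor characteristic, and finite sets of such points are Delta-transitive
   sets and are dense in the hyperspace. *)
theory Submission
  imports Defs
begin

subsection \<open>Integer iterates\<close>

lemma ziter_int [simp]: "ziter S f (int n) = f ^^ n"
  by (simp add: ziter_def)

lemma funpow_in:
  assumes "bij_betw f S S" "x \<in> S"
  shows "(f ^^ n) x \<in> S"
  using bij_betw_funpow[OF assms(1), of n] assms(2) by (meson bij_betwE)

lemma ziter_in:
  assumes "bij_betw f S S" "x \<in> S"
  shows "ziter S f n x \<in> S"
  using funpow_in[OF assms, of "nat n"] funpow_in[OF bij_betw_inv_into[OF assms(1)] assms(2), of "nat (- n)"]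
  by (simp add: ziter_def)

lemma ziter_add_one:
  assumes "bij_betw f S S" "x \<in> S"
  shows "ziter S f (n + 1) x = f (ziter S f n x)"
proof (cases "0 \<le> n")
  case True
  then show ?thesis by (simp add: ziter_def nat_add_distrib)
next
  case False
  then obtain k where n: "n = - int (Suc k)"
    by (metis int_cases not_less of_nat_0_le_iff)
  have "(inv_into S f ^^ k) x \<in> S"
    by (rule funpow_in[OF bij_betw_inv_into[OF assms(1)] assms(2)])
  then have "f (inv_into S f ((inv_into S f ^^ k) x)) = (inv_into S f ^^ k) x"
    by (rule bij_betw_inv_into_right[OF assms(1)])
  moreover have "nat (- n) = Suc k" "nat (- (n + 1)) = k" "(n + 1 \<ge> 0) = (k = 0)"
    using n by auto
  ultimately show ?thesis using False by (auto simp: ziter_def)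
qed

text \<open>An orbit over the integers is determined by its value at 0: injectivity of
  \<open>f\<close> on \<open>S\<close> makes the recursion reversible, which handles the downward
  induction step. Identities for negative times thus reduce to checking a recursion.\<close>

lemma ziter_eqI:
  assumes "bij_betw f S S" "\<And>n. g n \<in> S" "\<And>n. g (n + 1) = f (g n)"
  shows "ziter S f n (g 0) = g n"
proof (induction n rule: int_induct[where k = 0])
  case base
  show ?case by (simp add: ziter_def)
next
  case (step1 i)
  then show ?case using ziter_add_one[OF assms(1,2)] assms(3) by simp
next
  case (step2 i)
  have "f (ziter S f (i - 1) (g 0)) = f (g (i - 1))"
    using ziter_add_one[OF assms(1,2), of "i - 1" 0] assms(3)[of "i - 1"] step2 by simp
  then show ?case
    using assms(1,2) ziter_in[OF assms(1,2)] by (meson bij_betw_def inj_onD)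
qed

lemma ziter_add:
  assumes "bij_betw f S S" "x \<in> S"
  shows "ziter S f (m + n) x = ziter S f m (ziter S f n x)"
  using ziter_eqI[OF assms(1), of "\<lambda>k. ziter S f (k + n) x" m]
    ziter_in[OF assms] ziter_add_one[OF assms, of "_ + n"] by (simp add: ac_simps)

text \<open>At negative times \<open>ziter\<close> uses the inverse of \<open>tau\<close> on the
  whole product. The coordinatewise formula follows from uniqueness of orbits; \<open>?h\<close>,
  the coordinatewise inverse, serves to show that \<open>tau\<close> is a bijection of the
  product.\<close>

lemma ziter_tau:
  assumes "bij_betw T X X" "p \<in> power_carrier X d"
  shows "ziter (power_carrier X d) (tau T d) n p = (\<lambda>i\<in>{1..d}. ziter X T (int i * n) (p i))"
proof -
  let ?g = "\<lambda>n. \<lambda>i\<in>{1..d}. ziter X T (int i * n) (p i)"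
  let ?h = "\<lambda>q. \<lambda>i\<in>{1..d}. ziter X T (- int i) (q i)"
  have inv: "ziter X T (- int i) ((T ^^ i) x) = x" "(T ^^ i) (ziter X T (- int i) x) = x" if "x \<in> X" for i x
    using ziter_add[OF assms(1) that, of "- int i" "int i"] ziter_add[OF assms(1) that, of "int i" "- int i"]
    by (simp_all add: ziter_def)
  have "bij_betw (tau T d) (power_carrier X d) (power_carrier X d)"
    by (rule bij_betw_byWitness[where f' = ?h])
      (auto simp: tau_def PiE_iff extensional_def fun_eq_iff inv funpow_in[OF assms(1)] ziter_in[OF assms(1)])
  moreover have "?g n \<in> power_carrier X d" for n
    using assms(2) ziter_in[OF assms(1)] by (auto simp: PiE_iff)
  moreover have "?g (n + 1) = tau T d (?g n)" for n
  proof
    fix i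
    show "?g (n + 1) i = tau T d (?g n) i"
      using ziter_add[OF assms(1), of "p i" "int i" "int i * n"] assms(2)
      by (auto simp: tau_def PiE_iff algebra_simps)
  qed
  ultimately have "ziter (power_carrier X d) (tau T d) n (?g 0) = ?g n"
    by (rule ziter_eqI)
  moreover have "?g 0 = p"
    using assms(2) by (auto simp: ziter_def fun_eq_iff PiE_iff extensional_def)
  ultimately show ?thesis by simp
qed

section \<open>Return times and open conditions on orbits\<close>

text \<open>An index is required because it is membership in some \<open>zpreimage\<close> that
  places the common point in \<open>X\<close>; an empty intersection is the whole type.\<close>

lemma Inter_zpreimage_nonempty_iff:
  assumes "I \<noteq> {}"
  shows "(\<Inter>i\<in>I. zpreimage X T (k i) (U i)) \<noteq> {} \<longleftrightarrow> (\<exists>x\<in>X. \<forall>i\<in>I. ziter X T (k i) x \<in> U i)"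
  using assms by (auto simp: zpreimage_def)

lemma return_times_nonempty_iff:
  "return_times X T d U \<noteq> {} \<longleftrightarrow> (\<exists>n\<ge>1. \<exists>x\<in>X. \<forall>i\<le>d. (T ^^ (i * n)) x \<in> U i)"
proof -
  have "(\<Inter>i\<in>{0..d}. zpreimage X T (int (i * n)) (U i)) \<noteq> {} \<longleftrightarrow> (\<exists>x\<in>X. \<forall>i\<le>d. (T ^^ (i * n)) x \<in> U i)" for n
    by (subst Inter_zpreimage_nonempty_iff) (simp_all add: Ball_def del: of_nat_mult)
  then show ?thesis by (auto simp: return_times_def simp del: of_nat_mult)
qed

lemma tds_bij_betw: "tds X T \<Longrightarrow> bij_betw T X X"
  unfolding tds_def homeomorphism_def by (metis bij_betw_byWitness order_refl)

lemma continuous_on_funpow_self: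
  assumes "continuous_on X T" "T ` X \<subseteq> X"
  shows "continuous_on X (T ^^ n) \<and> (T ^^ n) ` X \<subseteq> X"
proof (induction n)
  case (Suc n)
  then have "continuous_on X (T \<circ> (T ^^ n))"
    using assms by (meson continuous_on_compose continuous_on_subset)
  then show ?case using Suc assms(2) by auto
qed (auto simp: continuous_on_id)

lemma openin_funpow_vimage:
  assumes "tds X T" "openin (top_of_set X) U"
  shows "openin (top_of_set X) {x \<in> X. (T ^^ n) x \<in> U}"
proof -
  have "continuous_on X T" "T ` X = X"
    using assms(1) by (auto simp: tds_def homeomorphism_def)
  then have "continuous_on X (T ^^ n)" "T ^^ n \<in> X \<rightarrow> X"
    using continuous_on_funpow_self[of X T n] by auto
  then have "openin (top_of_set X) (X \<inter> (T ^^ n) -` U)"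
    using assms(2) continuous_openin_preimage by blast
  then show ?thesis by (simp add: vimage_def Int_def)
qed

lemma openin_funpow_constraints:
  assumes "tds X T" "finite I" "\<And>i. i \<in> I \<Longrightarrow> openin (top_of_set X) (U i)"
  shows "openin (top_of_set X) {x \<in> X. \<forall>i\<in>I. (T ^^ k i) x \<in> U i}"
  using assms(2,3)
proof (induction I)
  case (insert j I)
  have "{x \<in> X. \<forall>i\<in>insert j I. (T ^^ k i) x \<in> U i}
        = {x \<in> X. (T ^^ k j) x \<in> U j} \<inter> {x \<in> X. \<forall>i\<in>I. (T ^^ k i) x \<in> U i}"
    by auto
  then show ?case
    using insert openin_funpow_vimage[OF assms(1), of "U j" "k j"] by auto
qed simp

lemma all_nat_iff_ge_1:
  fixes P :: "nat \<Rightarrow> bool"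
  assumes "P 0"
  shows "(\<forall>d. P d) \<longleftrightarrow> (\<forall>d\<ge>1. P d)"
  using assms by (metis One_nat_def Suc_leI not_gr_zero)

text \<open>Order 0 is included, where any point of \<open>U 0\<close> with \<open>n = 1\<close> is
  a witness. Inductions on the order can then start at 0.\<close>

lemma delta_transitive_iff:
  assumes "tds X T"
  shows "delta_transitive X T \<longleftrightarrow>
    (\<forall>d U. (\<forall>i\<le>d. openin (top_of_set X) (U i) \<and> U i \<noteq> {}) \<longrightarrow>
       (\<exists>n\<ge>1. \<exists>x\<in>X. \<forall>i\<le>d. (T ^^ (i * n)) x \<in> U i))" (is "_ \<longleftrightarrow> (\<forall>d U. ?hyp d U \<longrightarrow> ?goal d U)")
proof -
  have "?goal 0 U" if hyp: "?hyp 0 U" for U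
  proof -
    obtain x where "x \<in> U 0" using hyp by blast
    moreover have "x \<in> X" using hyp \<open>x \<in> U 0\<close> openin_subset by fastforce
    ultimately show ?thesis by auto
  qed
  then have zero: "\<forall>U. ?hyp 0 U \<longrightarrow> ?goal 0 U" by blast
  from all_nat_iff_ge_1[of "\<lambda>d. \<forall>U. ?hyp d U \<longrightarrow> ?goal d U", OF zero]
  have "(\<forall>d U. ?hyp d U \<longrightarrow> ?goal d U) \<longleftrightarrow> (\<forall>d\<ge>1. \<forall>U. ?hyp d U \<longrightarrow> ?goal d U)" .
  then show ?thesis
    unfolding delta_transitive_def delta_transitive_of_order_def return_times_nonempty_iff
    by (simp add: Ball_def)
qed

subsection \<open>Independence along arithmetic progressions gives transitivity\<close>

text \<open>Normalises independence: positions run from 0 instead of 1, and the difference is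
  positive. The extra term of order \<open>Suc d\<close> pays for moving the base point along the
  progression, and a negative difference is handled by reading the progression backwards.\<close>

lemma Ind_ap_common_difference:
  assumes "tds X T" "Ind_ap X T = X \<times> X"
    and V: "openin (top_of_set X) V" "V \<noteq> {}" and W: "openin (top_of_set X) W" "W \<noteq> {}"
  shows "\<exists>n\<ge>1. \<forall>t. \<exists>x\<in>X. \<forall>i\<le>d. (T ^^ (i * n)) x \<in> (if t i then V else W)"
proof -
  note bij = tds_bij_betw[OF assms(1)]
  obtain v w where vw: "v \<in> V" "w \<in> W" using V W by auto
  have sub: "V \<subseteq> X" "W \<subseteq> X" using V W openin_imp_subset by auto
  define U where "U k = (if k = 1 then V else W)" for k :: nat
  have "(v, w) \<in> Ind_ap X T" using assms(2) vw sub by auto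
  then have "ind_ap_pair X T (Suc d) (v, w)" by (simp add: Ind_ap_def)
  note pair = this[unfolded ind_ap_pair_def, THEN conjunct2, THEN spec[of _ U], THEN mp]
  obtain n where "n \<noteq> 0" and
    n': "\<forall>t \<in> {1..Suc d} \<rightarrow> {1, 2}.
      (\<Inter>i\<in>{1..Suc d}. zpreimage X T (int i * n) (U (t i))) \<noteq> {}"
    using pair vw sub V W by (auto simp: U_def interior_of_openin)
  have n: "\<exists>x\<in>X. \<forall>i\<in>{1..Suc d}. ziter X T (int i * n) x \<in> (if t i then V else W)" for t
  proof -
    have "(\<lambda>i. if t i then 1 else 2) \<in> {1..Suc d} \<rightarrow> {1, 2::nat}" by auto
    from n'[THEN bspec, OF this] show ?thesis
      unfolding U_def by (subst (asm) Inter_zpreimage_nonempty_iff) (auto split: if_splits)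
  qed
  show ?thesis
  proof (cases "n > 0")
    case True
    define m where "m = nat n"
    have m: "n = int m" "m \<ge> 1" using True by (simp_all add: m_def)
    have "\<exists>x\<in>X. \<forall>i\<le>d. (T ^^ (i * m)) x \<in> (if t i then V else W)" for t
    proof -
      \<comment> \<open>The word is shifted by one, so that the image of \<open>x\<close> under the
        \<open>n\<close>-th iterate becomes the term at position 0.\<close>
      obtain x where x: "x \<in> X"
        "\<forall>i\<in>{1..Suc d}. ziter X T (int i * n) x \<in> (if t (i - 1) then V else W)"
        by (rule bexE[OF n[of "\<lambda>i. t (i - 1)"]])
      have "(T ^^ (i * m)) (ziter X T n x) \<in> (if t i then V else W)" if "i \<le> d" for i
      proof -
        have "int (i * m) + n = int (Suc i) * n"
          using m(1) by (simp add: algebra_simps)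
        then have "(T ^^ (i * m)) (ziter X T n x) = ziter X T (int (Suc i) * n) x"
          using ziter_add[OF bij x(1), of "int (i * m)" n] by (metis ziter_int)
        then show ?thesis using x(2)[THEN bspec, of "Suc i"] that by simp
      qed
      then show ?thesis using ziter_in[OF bij x(1)] by blast
    qed
    then show ?thesis using m(2) by blast
  next
    case False
    define m where "m = nat (- n)"
    have m: "n = - int m" "m \<ge> 1" using False \<open>n \<noteq> 0\<close> by (simp_all add: m_def)
    have "\<exists>x\<in>X. \<forall>i\<le>d. (T ^^ (i * m)) x \<in> (if t i then V else W)" for t
    proof -
      \<comment> \<open>The word is reversed, so that the last term of the progression becomes the
        base point and the positive step \<open>m\<close> runs back towards its first term.\<close>
      obtain x where x: "x \<in> X"
        "\<forall>i\<in>{1..Suc d}. ziter X T (int i * n) x \<in> (if t (Suc d - i) then V else W)"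
        by (rule bexE[OF n[of "\<lambda>i. t (Suc d - i)"]])
      have "(T ^^ (i * m)) (ziter X T (int (Suc d) * n) x) \<in> (if t i then V else W)" if "i \<le> d" for i
      proof -
        have "int (i * m) + int (Suc d) * n = int (Suc d - i) * n"
          using that m(1) by (simp add: of_nat_diff algebra_simps)
        then have "(T ^^ (i * m)) (ziter X T (int (Suc d) * n) x) = ziter X T (int (Suc d - i) * n) x"
          using ziter_add[OF bij x(1), of "int (i * m)" "int (Suc d) * n"] by (metis ziter_int)
        then show ?thesis using x(2)[THEN bspec, of "Suc d - i"] that by simp
      qed
      then show ?thesis using ziter_in[OF bij x(1)] by blast
    qed
    then show ?thesis using m(2) by blast
  qed
qed

lemma Ind_ap_imp_delta_transitive:
  assumes "tds X T" "Ind_ap X T = X \<times> X"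
  shows "delta_transitive X T"
proof -
  note bij = tds_bij_betw[OF assms(1)]
  have "\<exists>n\<ge>1. \<exists>x\<in>X. \<forall>i\<le>d. (T ^^ (i * n)) x \<in> U i"
    if "\<forall>i\<le>d. openin (top_of_set X) (U i) \<and> U i \<noteq> {}" for d U
    using that
  proof (induction d)
    case 0
    then obtain x where "x \<in> U 0" by auto
    moreover have "x \<in> X" using 0 \<open>x \<in> U 0\<close> openin_subset by fastforce
    ultimately show ?case by auto
  next
    case (Suc d)
    then obtain s where s: "s \<ge> 1" "\<exists>x\<in>X. \<forall>i\<le>d. (T ^^ (i * s)) x \<in> U i" by auto
    define V where "V = {x \<in> X. \<forall>i\<in>{..d}. (T ^^ (i * s)) x \<in> U i}"
    define W where "W = {x \<in> X. (T ^^ (Suc d * s)) x \<in> U (Suc d)}"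
    have "openin (top_of_set X) V" "openin (top_of_set X) W"
      unfolding V_def W_def using Suc.prems
      by (auto intro!: openin_funpow_constraints openin_funpow_vimage assms(1) simp del: mult_Suc)
    moreover have "V \<noteq> {}" using s(2) by (auto simp: V_def)
    moreover have "W \<noteq> {}"
    \<comment> \<open>Iterates of \<open>T\<close> map \<open>X\<close> onto \<open>X\<close>, so
      any point of \<open>U (Suc d)\<close> has a preimage under the required iterate.\<close>
    proof -
      have "openin (top_of_set X) (U (Suc d))" "U (Suc d) \<noteq> {}" using Suc.prems by auto
      then obtain y where "y \<in> U (Suc d)" "y \<in> X"
        using openin_imp_subset by blast
      then have "y \<in> (T ^^ (Suc d * s)) ` X"
        using bij_betw_imp_surj_on[OF bij_betw_funpow[OF bij]] by simp
      then obtain x where "x \<in> X" "(T ^^ (Suc d * s)) x = y" by (rule imageE) simp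
      then have "x \<in> W"
        using \<open>y \<in> U (Suc d)\<close> by (simp add: W_def del: mult_Suc)
      then show ?thesis by blast
    qed
    ultimately obtain n where "n \<ge> 1"
      and n': "\<forall>t. \<exists>x\<in>X. \<forall>i\<le>Suc d. (T ^^ (i * n)) x \<in> (if t i then V else W)"
      using Ind_ap_common_difference[OF assms, of V W "Suc d"] by blast
    obtain x where "x \<in> X" and x: "\<forall>i\<le>Suc d. (T ^^ (i * n)) x \<in> (if i \<le> d then V else W)"
      by (rule bexE[OF n'[THEN spec, of "\<lambda>i. i \<le> d"]])
    \<comment> \<open>The exponent splits as \<open>i * n + i * s\<close>. For \<open>i\<close> at
      most \<open>d\<close> the point after \<open>i * n\<close> steps lies in \<open>V\<close>, and
      of the conditions defining \<open>V\<close> exactly the one with index \<open>i\<close> is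
      used; for \<open>i = Suc d\<close> the set \<open>W\<close> gives the last target.\<close>
    have "(T ^^ (i * (n + s))) x \<in> U i" if "i \<le> Suc d" for i
    proof -
      have "(T ^^ (i * (n + s))) x = (T ^^ (i * s)) ((T ^^ (i * n)) x)"
        by (simp add: distrib_left add.commute[of "i * n"] funpow_add)
      then show ?thesis
        using x[rule_format, OF that] that by (cases "i = Suc d") (auto simp: V_def W_def simp del: mult_Suc)
    qed
    then show ?case using \<open>n \<ge> 1\<close> \<open>x \<in> X\<close> by (intro exI[of _ "n + s"]) auto
  qed
  then show ?thesis using delta_transitive_iff[OF assms(1)] by blast
qed

subsection \<open>Transitivity gives independence\<close>

text \<open>Common source of independence for the two conditions that imply it. The hypothesis
  provides a difference for one prescribed list of targets, while independence asks for one
  difference serving all words; listing all words one after another in a single long progression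
  bridges this gap.\<close>

lemma Ind_ap_eqI:
  assumes "tds X T"
    and hit: "\<And>d U. \<forall>i\<in>{1..d}. openin (top_of_set X) (U i) \<and> U i \<noteq> {} \<Longrightarrow>
      \<exists>n::int. n \<noteq> 0 \<and> (\<exists>x\<in>X. \<forall>i\<in>{1..d}. ziter X T (int i * n) x \<in> U i)"
  shows "Ind_ap X T = X \<times> X"
proof -
  note bij = tds_bij_betw[OF assms(1)]
  have common: "\<exists>n::int. n \<noteq> 0 \<and>
           (\<forall>t \<in> {1..d} \<rightarrow> {1, 2}. (\<Inter>i\<in>{1..d}. zpreimage X T (int i * n) (U (t i))) \<noteq> {})"
    if d: "d \<ge> 1" and p: "fst p \<in> top_of_set X interior_of U 1" "snd p \<in> top_of_set X interior_of U 2"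
    for d p and U :: "nat \<Rightarrow> 'a set"
  proof -
    let ?A = "{1..d} \<rightarrow>\<^sub>E {1, 2::nat}"
    \<comment> \<open>\<open>e\<close> enumerates the finitely many words of length \<open>d\<close>
      over the two letters, with numbering from 0.\<close>
    obtain e where e: "bij_betw e {0..<card ?A} ?A"
      using ex_bij_betw_nat_finite[of ?A] by (auto simp: finite_PiE)
    define M where "M = card ?A"
    \<comment> \<open>Position \<open>k = d * j + i\<close> with \<open>i\<close> between 1 and
      \<open>d\<close> carries letter \<open>i\<close> of word \<open>j\<close>. Positions start at
      1, hence the subtraction before \<open>div\<close> and \<open>mod\<close> and the successor
      after it.\<close>
    define w where "w k = e ((k - 1) div d) (Suc ((k - 1) mod d))" for k
    have "w k \<in> {1, 2}" if "k \<in> {1..d * M}" for k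
    proof -
      have "k - 1 < d * M" using that by auto
      then have "(k - 1) div d < M" by (simp add: less_mult_imp_div_less mult.commute)
      then have "e ((k - 1) div d) \<in> ?A" using bij_betwE[OF e] by (simp add: M_def)
      moreover have "Suc ((k - 1) mod d) \<in> {1..d}"
        using d by (simp add: Suc_leI)
      ultimately show ?thesis unfolding w_def by (rule PiE_mem)
    qed
    then have "\<forall>k\<in>{1..d * M}. openin (top_of_set X) (top_of_set X interior_of U (w k)) \<and>
        top_of_set X interior_of U (w k) \<noteq> {}"
      using p by fastforce
    from hit[OF this] obtain n x where n: "n \<noteq> 0" and x: "x \<in> X"
      and hits: "\<forall>k\<in>{1..d * M}. ziter X T (int k * n) x \<in> top_of_set X interior_of U (w k)"
      by blast
    have "(\<Inter>i\<in>{1..d}. zpreimage X T (int i * n) (U (t i))) \<noteq> {}" if t: "t \<in> {1..d} \<rightarrow> {1, 2}" for t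
    proof -
      \<comment> \<open>The words enumerated by \<open>e\<close> are extensional, so
        \<open>t\<close> is first cut down to its relevant positions.\<close>
      have "restrict t {1..d} \<in> ?A" using t by auto
      then have "restrict t {1..d} \<in> e ` {0..<M}"
        using bij_betw_imp_surj_on[OF e] by (simp add: M_def)
      then obtain j where j: "j < M" "e j = restrict t {1..d}" by (rule imageE) simp
      \<comment> \<open>Block \<open>j\<close> of the long progression starts after
        \<open>d * j\<close> steps; taking that point as the new base point reads off the word
        \<open>t\<close>.\<close>
      have "ziter X T (int i * n) (ziter X T (int (d * j) * n) x) \<in> U (t i)" if i: "i \<in> {1..d}" for i
      proof -
        have "w (d * j + i) = t i"
        proof -
          have "d * j + i - 1 = d * j + (i - 1)" "i - 1 < d" using i by auto
          then have "(d * j + i - 1) div d = j" "(d * j + i - 1) mod d = i - 1"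
            by simp_all
          then show ?thesis using i j(2) by (simp add: w_def)
        qed
        moreover have "d * j + i \<in> {1..d * M}"
        proof -
          have "d * j + i \<le> d * Suc j" using i by simp
          also have "\<dots> \<le> d * M" using j(1) by (intro mult_le_mono) auto
          finally show ?thesis using i by auto
        qed
        ultimately have "ziter X T (int (d * j + i) * n) x \<in> U (t i)"
          using hits interior_of_subset by (metis subsetD)
        moreover have "int (d * j + i) * n = int i * n + int (d * j) * n"
          by (simp add: algebra_simps)
        ultimately show ?thesis by (simp only: ziter_add[OF bij x])
      qed
      then have "\<exists>y\<in>X. \<forall>i\<in>{1..d}. ziter X T (int i * n) y \<in> U (t i)"
        using ziter_in[OF bij x] by blast
      moreover have "{1..d} \<noteq> {}" using d by simp
      ultimately show ?thesis by (simp only: Inter_zpreimage_nonempty_iff not_False_eq_True)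
    qed
    then show ?thesis using n by (intro exI[of _ n]) simp
  qed
  have "ind_ap_pair X T d p" if "d \<ge> 1" "p \<in> X \<times> X" for d p
    unfolding ind_ap_pair_def
  proof (intro conjI allI impI)
    show "p \<in> X \<times> X" by (rule that)
  qed (rule common[where p = p, OF \<open>d \<ge> 1\<close>], simp_all)
  then show ?thesis by (auto simp: Ind_ap_def)
qed

lemma delta_transitive_imp_Ind_ap:
  assumes "tds X T" "delta_transitive X T"
  shows "Ind_ap X T = X \<times> X"
proof (rule Ind_ap_eqI[OF assms(1)])
  fix d and U :: "nat \<Rightarrow> 'a set"
  assume U: "\<forall>i\<in>{1..d}. openin (top_of_set X) (U i) \<and> U i \<noteq> {}"
  have "X \<noteq> {}" using assms(1) by (simp add: tds_def)
  \<comment> \<open>Independence constrains only positions from 1 on, so position 0 receives the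
    whole space as target.\<close>
  then have "\<forall>i\<le>d. openin (top_of_set X) ((U(0 := X)) i) \<and> (U(0 := X)) i \<noteq> {}"
    using U by auto
  then obtain n x where n: "n \<ge> 1" "x \<in> X" "\<forall>i\<le>d. (T ^^ (i * n)) x \<in> (U(0 := X)) i"
    using assms(2)[unfolded delta_transitive_iff[OF assms(1)]] by blast
  have "\<forall>i\<in>{1..d}. ziter X T (int i * int n) x \<in> U i"
  proof
    fix i assume "i \<in> {1..d}"
    then have "(T ^^ (i * n)) x \<in> U i"
      using n(3)[rule_format, of i] by simp
    then show "ziter X T (int i * int n) x \<in> U i" by (metis of_nat_mult ziter_int)
  qed
  moreover have "int n \<noteq> 0" using n(1) by simp
  ultimately show "\<exists>n::int. n \<noteq> 0 \<and> (\<exists>x\<in>X. \<forall>i\<in>{1..d}. ziter X T (int i * n) x \<in> U i)"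
    using n(2) by blast
qed

subsection \<open>The trivial characteristic factor\<close>

lemma topspace_power_topology: "topspace (power_topology X d) = power_carrier X d"
  by simp

lemma diagonal_orbit_closure_eq:
  assumes "tds X T" "x \<in> X"
  shows "diagonal_orbit_closure X T d x =
    power_topology X d closure_of range (\<lambda>n. \<lambda>i\<in>{1..d}. ziter X T (int i * n) x)"
proof -
  have "ziter (power_carrier X d) (tau T d) n (\<lambda>i\<in>{1..d}. x) = (\<lambda>i\<in>{1..d}. ziter X T (int i * n) x)" for n
    using assms(2) by (subst ziter_tau[OF tds_bij_betw[OF assms(1)]]) auto
  then show ?thesis by (simp add: diagonal_orbit_closure_def)
qed

text \<open>Over a one-point factor the whole power is a single fibre, so a non-empty saturated
  orbit closure is everything. The diagonal orbit is therefore dense and enters every open box; what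
  remains is to make sure that it does so at a nonzero time.\<close>

lemma trivial_characteristic_factor_imp_Ind_ap:
  assumes "tds X T" "\<forall>d\<ge>2. trivial_top_characteristic_factor d X T"
  shows "Ind_ap X T = X \<times> X"
proof (rule Ind_ap_eqI[OF assms(1)])
  fix d and U :: "nat \<Rightarrow> 'a set"
  assume U: "\<forall>i\<in>{1..d}. openin (top_of_set X) (U i) \<and> U i \<noteq> {}"
  note bij = tds_bij_betw[OF assms(1)]
  obtain a where a: "a \<in> X" using assms(1) by (auto simp: tds_def)
  show "\<exists>n::int. n \<noteq> 0 \<and> (\<exists>x\<in>X. \<forall>i\<in>{1..d}. ziter X T (int i * n) x \<in> U i)"
  proof (cases "X = {a}")
    \<comment> \<open>A one-point space has no two disjoint non-empty targets, but there every
      target is the whole space and time 1 works.\<close>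
    case True
    have "ziter X T (int i * 1) a \<in> U i" if "i \<in> {1..d}" for i
    proof -
      have "U i \<subseteq> X" "U i \<noteq> {}" using U that openin_imp_subset by blast+
      then show ?thesis using True ziter_in[OF bij a, of "int i * 1"] by auto
    qed
    then show ?thesis using a zero_neq_one by metis
  next
    case False
    then obtain b where b: "b \<in> X" "a \<noteq> b" using a by blast
    obtain P Q where PQ: "open P" "open Q" "a \<in> P" "b \<in> Q" "P \<inter> Q = {}"
      using hausdorff[OF b(2)] by blast
    \<comment> \<open>Two extra coordinates with disjoint targets exclude the trivial solution \<open>n = 0\<close>.\<close>
    define V where "V i = (if i \<le> d then U i else if i = Suc d then X \<inter> P else X \<inter> Q)" for i
    define D where "D = d + 2"
    have V: "openin (top_of_set X) (V i)" "V i \<noteq> {}" if "i \<in> {1..D}" for i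
      using U that PQ a b by (auto simp: V_def D_def intro: openin_open_Int)
    have VX: "V i \<subseteq> X" if "i \<in> {1..D}" for i
      using V(1)[OF that] openin_imp_subset by blast
    have "trivial_top_characteristic_factor D X T" using assms(2) by (simp add: D_def)
    then obtain X0 where X0: "top_of_set X closure_of X0 = X"
      "\<forall>x\<in>X0. saturated X (\<lambda>_. 0::real) D (diagonal_orbit_closure X T D x)"
      "gdelta_in (top_of_set X) X0"
      unfolding trivial_top_characteristic_factor_def top_characteristic_factor_def by blast
    have "X0 \<noteq> {}" using X0(1) a by auto
    then obtain x where x: "x \<in> X0" "x \<in> X" using gdelta_in_subset[OF X0(3)] by auto
    let ?orb = "\<lambda>n. \<lambda>i\<in>{1..D}. ziter X T (int i * n) x"
    let ?L = "power_topology X D closure_of range ?orb"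
    have orb: "?orb n \<in> power_carrier X D" for n
      using ziter_in[OF bij x(2)] by auto
    have "range ?orb \<subseteq> ?L"
      by (intro closure_of_subset) (simp only: topspace_power_topology image_subset_iff orb ball_UNIV simp_thms)
    then have "?orb 0 \<in> ?L" by blast
    moreover have "saturated X (\<lambda>_. 0::real) D ?L"
      using bspec[OF X0(2) x(1)] by (simp only: diagonal_orbit_closure_eq[OF assms(1) x(2)])
    \<comment> \<open>The diagonal point, reached at time 0, lies in the closure, and every point of
      the power has the same image as it.\<close>
    ultimately have L: "power_carrier X D \<subseteq> ?L"
      unfolding saturated_def by blast
    have "\<forall>i. \<exists>y. i \<in> {1..D} \<longrightarrow> y \<in> V i" using V(2) by blast
    then obtain f where f: "\<And>i. i \<in> {1..D} \<Longrightarrow> f i \<in> V i" by metis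
    have "restrict f {1..D} \<in> ?L"
      using f VX by (intro subsetD[OF L]) (auto simp: PiE_iff subset_iff)
    then have "\<forall>W. restrict f {1..D} \<in> W \<and> openin (power_topology X D) W \<longrightarrow> (\<exists>y. y \<in> range ?orb \<and> y \<in> W)"
      unfolding in_closure_of by (rule conjunct2)
    moreover have "restrict f {1..D} \<in> PiE {1..D} V" using f by auto
    moreover have "openin (power_topology X D) (PiE {1..D} V)"
      using V(1) by (simp add: openin_PiE)
    ultimately obtain y where "y \<in> range ?orb" "y \<in> PiE {1..D} V" by blast
    then obtain n where "?orb n \<in> PiE {1..D} V" by auto
    then have n: "ziter X T (int i * n) x \<in> V i" if "i \<in> {1..D}" for i
      using that by (auto simp: PiE_iff)
    have "n \<noteq> 0"
    proof
      assume "n = 0"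
      then have "x \<in> V (d + 1)" "x \<in> V (d + 2)"
        using n[of "d + 1"] n[of "d + 2"] by (simp_all add: ziter_def D_def)
      then show False using PQ(5) by (auto simp: V_def)
    qed
    moreover have "\<forall>i\<in>{1..d}. ziter X T (int i * n) x \<in> U i"
    proof
      fix i assume "i \<in> {1..d}"
      then show "ziter X T (int i * n) x \<in> U i" using n[of i] by (simp add: V_def D_def)
    qed
    ultimately show ?thesis using x(2) by blast
  qed
qed

section \<open>Baire category and generic points\<close>

text \<open>The ambient type is an arbitrary metric space, so countability comes from compactness of
  \<open>X\<close>: total boundedness gives finite covers by balls of radius
  \<open>1 / (k + 1)\<close> for each \<open>k\<close>, and all these balls together form a
  base.\<close>

lemma compact_countable_base:
  fixes X :: "'a::metric_space set"
  assumes "compact X"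
  obtains \<B> where "countable \<B>" "\<forall>V\<in>\<B>. openin (top_of_set X) V"
    "\<forall>U x. openin (top_of_set X) U \<and> x \<in> U \<longrightarrow> (\<exists>V\<in>\<B>. x \<in> V \<and> V \<subseteq> U)"
proof -
  have "\<exists>K. finite K \<and> X \<subseteq> (\<Union>c\<in>K. ball c (inverse (real (Suc k))))" for k
    using assms seq_compact_imp_totally_bounded[of X] compact_imp_seq_compact
    by (metis inverse_positive_iff_positive of_nat_0_less_iff zero_less_Suc)
  then obtain K where K: "\<And>k. finite (K k)" "\<And>k. X \<subseteq> (\<Union>c\<in>K k. ball c (inverse (real (Suc k))))"
    by metis
  define \<B> where "\<B> = (\<Union>k. (\<lambda>c. X \<inter> ball c (inverse (real (Suc k)))) ` K k)"
  show ?thesis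
  proof
    show "countable \<B>" unfolding \<B>_def using K(1) by (auto intro: countable_finite)
    show "\<forall>V\<in>\<B>. openin (top_of_set X) V"
      by (auto simp: \<B>_def)
    show "\<forall>U x. openin (top_of_set X) U \<and> x \<in> U \<longrightarrow> (\<exists>V\<in>\<B>. x \<in> V \<and> V \<subseteq> U)"
    proof (intro allI impI, elim conjE)
      fix U x assume U: "openin (top_of_set X) U" "x \<in> U"
      obtain e where e: "e > 0" "ball x e \<inter> X \<subseteq> U" and xX: "x \<in> X"
        using U openin_contains_ball[of X U] by blast
      obtain k where k: "inverse (real (Suc k)) < e / 2"
        using reals_Archimedean[of "e / 2"] e(1) by auto
      obtain c where c: "c \<in> K k" "x \<in> ball c (inverse (real (Suc k)))" using K(2) xX by blast
      \<comment> \<open>The ball contains \<open>x\<close> and its radius is below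
        \<open>e / 2\<close>, so all its points are within \<open>e\<close> of
        \<open>x\<close>.\<close>
      have "X \<inter> ball c (inverse (real (Suc k))) \<subseteq> U"
      proof
        fix y assume y: "y \<in> X \<inter> ball c (inverse (real (Suc k)))"
        have "dist x y \<le> dist c x + dist c y" by (metis dist_commute dist_triangle)
        also have "\<dots> < e" using y c(2) k by simp
        finally show "y \<in> U" using e(2) y by auto
      qed
      moreover have "X \<inter> ball c (inverse (real (Suc k))) \<in> \<B>" using c(1) by (auto simp: \<B>_def)
      ultimately show "\<exists>V\<in>\<B>. x \<in> V \<and> V \<subseteq> U" using c(2) xX by blast
    qed
  qed
qed

text \<open>Finite lists of base sets are countable in number, so a single residual set serves all
  orders and all targets at once. For each list, the set of points that hit it is open, and it is
  dense by transitivity.\<close>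

lemma delta_transitive_generic_points:
  fixes X :: "'a::metric_space set"
  assumes "tds X T" "delta_transitive X T"
  obtains X0 where "gdelta_in (top_of_set X) X0" "top_of_set X closure_of X0 = X"
    "\<forall>x\<in>X0. \<forall>d U. (\<forall>i\<in>{1..d}. openin (top_of_set X) (U i) \<and> U i \<noteq> {}) \<longrightarrow>
       (\<exists>n\<ge>1. \<forall>i\<in>{1..d}. (T ^^ (i * n)) x \<in> U i)"
proof -
  have "compact X" using assms(1) by (simp add: tds_def)
  then obtain \<B> where B: "countable \<B>" "\<forall>V\<in>\<B>. openin (top_of_set X) V"
    "\<forall>U x. openin (top_of_set X) U \<and> x \<in> U \<longrightarrow> (\<exists>V\<in>\<B>. x \<in> V \<and> V \<subseteq> U)"
    by (rule compact_countable_base)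
  \<comment> \<open>List entries are numbered from 0 but targets from 1, hence \<open>Suc i\<close>
    in the exponent.\<close>
  define G where "G Us = (\<Union>n\<in>{1..}. {x \<in> X. \<forall>i\<in>{..<length Us}. (T ^^ (Suc i * n)) x \<in> Us ! i})" for Us
  \<comment> \<open>Empty base sets are excluded because no point could hit them, and density would
    fail.\<close>
  define \<G> where "\<G> = G ` lists (\<B> - {{}})"
  have G: "openin (top_of_set X) (G Us) \<and> top_of_set X closure_of G Us = X"
    if Us: "Us \<in> lists (\<B> - {{}})" for Us
  proof
    have Us': "openin (top_of_set X) (Us ! i)" "Us ! i \<noteq> {}" if "i < length Us" for i
      using Us that B(2) by (auto simp: lists_eq_set subset_iff)
    show "openin (top_of_set X) (G Us)"
      unfolding G_def
      by (intro openin_Union ballI)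
        (auto intro!: openin_funpow_constraints assms(1) Us'(1) simp del: mult_Suc)
    have "\<exists>y. y \<in> G Us \<and> y \<in> W" if W: "openin (top_of_set X) W" "x \<in> W" for x W
    proof -
      \<comment> \<open>Using \<open>W\<close> as the target at position 0 makes the point found by
        transitivity lie in \<open>W\<close> itself.\<close>
      define U where "U i = (if i = 0 then W else Us ! (i - 1))" for i
      have "\<forall>i\<le>length Us. openin (top_of_set X) (U i) \<and> U i \<noteq> {}"
        using W Us' by (auto simp: U_def)
      then obtain n y where n: "n \<ge> 1" "y \<in> X" "\<forall>i\<le>length Us. (T ^^ (i * n)) y \<in> U i"
        using assms(2)[unfolded delta_transitive_iff[OF assms(1)]] by blast
      have "(T ^^ (Suc i * n)) y \<in> Us ! i" if "i < length Us" for i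
        using n(3)[rule_format, of "Suc i"] that by (simp add: U_def del: mult_Suc)
      moreover have "y \<in> W" using n(3)[rule_format, of 0] by (simp add: U_def)
      ultimately show ?thesis using n(1,2) by (intro exI[of _ y]) (auto simp: G_def simp del: mult_Suc)
    qed
    then show "top_of_set X closure_of G Us = X"
      by (auto simp: in_closure_of)
  qed
  have cG: "countable \<G>" unfolding \<G>_def using B(1) by auto
  \<comment> \<open>The intersection must run over a non-empty family for
    \<open>gdelta_in_Inter\<close>.\<close>
  have "G [] \<in> \<G>" by (auto simp: \<G>_def)
  show ?thesis
  proof
    show "gdelta_in (top_of_set X) (\<Inter>\<G>)"
      using cG \<open>G [] \<in> \<G>\<close> G by (intro gdelta_in_Inter) (auto simp: \<G>_def intro: open_imp_gdelta_in)
    have "locally_compact_space (top_of_set X)"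
      using \<open>compact X\<close> by (simp add: compact_imp_locally_compact_space compact_space_subtopology)
    moreover have "regular_space (top_of_set X)"
      by (simp add: metrizable_imp_regular_space metrizable_space_subtopology metrizable_space_euclidean)
    ultimately have "top_of_set X closure_of \<Inter>\<G> = topspace (top_of_set X)"
      using cG G by (intro Baire_category) (auto simp: \<G>_def)
    then show "top_of_set X closure_of \<Inter>\<G> = X" by simp
    show "\<forall>x\<in>\<Inter>\<G>. \<forall>d U. (\<forall>i\<in>{1..d}. openin (top_of_set X) (U i) \<and> U i \<noteq> {}) \<longrightarrow>
       (\<exists>n\<ge>1. \<forall>i\<in>{1..d}. (T ^^ (i * n)) x \<in> U i)"
    proof (intro ballI allI impI)
      fix x d and U :: "nat \<Rightarrow> 'a set"
      assume x: "x \<in> \<Inter>\<G>" and U: "\<forall>i\<in>{1..d}. openin (top_of_set X) (U i) \<and> U i \<noteq> {}"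
      have "\<forall>i\<in>{1..d}. \<exists>V. V \<in> \<B> - {{}} \<and> V \<subseteq> U i"
      proof
        fix i assume "i \<in> {1..d}"
        then obtain y where "openin (top_of_set X) (U i)" "y \<in> U i" using U by blast
        then obtain W where "W \<in> \<B>" "y \<in> W" "W \<subseteq> U i" using B(3) by blast
        then show "\<exists>V. V \<in> \<B> - {{}} \<and> V \<subseteq> U i" by blast
      qed
      from bchoice[OF this] obtain V where V: "\<forall>i\<in>{1..d}. V i \<in> \<B> - {{}} \<and> V i \<subseteq> U i" ..
      define Us where "Us = map (\<lambda>i. V (Suc i)) [0..<d]"
      have "V (Suc i) \<in> \<B> - {{}}" if "i < d" for i
        using bspec[OF V, of "Suc i"] that by simp
      then have "Us \<in> lists (\<B> - {{}})" by (auto simp: Us_def in_lists_conv_set)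
      then have "x \<in> G Us" using x by (auto simp: \<G>_def)
      then obtain n where n: "n \<ge> 1" "\<forall>i\<in>{..<d}. (T ^^ (Suc i * n)) x \<in> Us ! i"
        by (auto simp: G_def Us_def simp del: mult_Suc)
      have "(T ^^ (i * n)) x \<in> U i" if i: "i \<in> {1..d}" for i
      proof -
        obtain j where j: "i = Suc j" "j < d" using i by (cases i) auto
        then have "(T ^^ (i * n)) x \<in> V i" using bspec[OF n(2), of j] by (simp add: Us_def del: mult_Suc)
        then show ?thesis using V i by blast
      qed
      then show "\<exists>n\<ge>1. \<forall>i\<in>{1..d}. (T ^^ (i * n)) x \<in> U i" using n(1) by blast
    qed
  qed
qed

text \<open>The diagonal orbit of a generic point meets every basic box, already at positive times.
  Its closure is the whole power, which is saturated.\<close>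

lemma delta_transitive_imp_trivial_characteristic_factor:
  assumes "tds X T" "delta_transitive X T"
  shows "trivial_top_characteristic_factor d X T"
proof -
  obtain X0 where X0: "gdelta_in (top_of_set X) X0" "top_of_set X closure_of X0 = X"
    "\<forall>x\<in>X0. \<forall>d U. (\<forall>i\<in>{1..d}. openin (top_of_set X) (U i) \<and> U i \<noteq> {}) \<longrightarrow>
       (\<exists>n\<ge>1. \<forall>i\<in>{1..d}. (T ^^ (i * n)) x \<in> U i)"
    by (rule delta_transitive_generic_points[OF assms])
  have "tds {0::real} id"
    unfolding tds_def by (auto intro!: exI[of _ id] simp: homeomorphism_def)
  then have "factor_map X T {0::real} id (\<lambda>_. 0)"
    using assms(1) by (auto simp: factor_map_def tds_def)
  moreover have "saturated X (\<lambda>_. 0::real) d (diagonal_orbit_closure X T d x)" if x: "x \<in> X0" for x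
  proof -
    have "x \<in> X" using x gdelta_in_subset[OF X0(1)] by auto
    have "p \<in> diagonal_orbit_closure X T d x" if p: "p \<in> power_carrier X d" for p
      unfolding diagonal_orbit_closure_eq[OF assms(1) \<open>x \<in> X\<close>] in_closure_of
    proof (intro conjI allI impI)
      show "p \<in> topspace (power_topology X d)" using p by simp
      fix W assume "p \<in> W \<and> openin (power_topology X d) W"
      then obtain U where U: "\<forall>i\<in>{1..d}. openin (top_of_set X) (U i)" "p \<in> PiE {1..d} U" "PiE {1..d} U \<subseteq> W"
        unfolding openin_product_topology_alt by blast
      then have "\<forall>i\<in>{1..d}. openin (top_of_set X) (U i) \<and> U i \<noteq> {}" by (auto simp: PiE_iff)
      from X0(3)[rule_format, OF x, of d U] this obtain n where n: "\<forall>i\<in>{1..d}. (T ^^ (i * n)) x \<in> U i" by blast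
      have "ziter X T (int i * int n) x \<in> U i" if "i \<in> {1..d}" for i
        using n[rule_format, OF that] by (metis of_nat_mult ziter_int)
      then have "(\<lambda>i\<in>{1..d}. ziter X T (int i * int n) x) \<in> W"
        using U(3) by (intro subsetD[OF U(3)]) simp
      then show "\<exists>y. y \<in> range (\<lambda>n. \<lambda>i\<in>{1..d}. ziter X T (int i * n) x) \<and> y \<in> W" by blast
    qed
    then show ?thesis unfolding saturated_def by blast
  qed
  ultimately show ?thesis
    unfolding trivial_top_characteristic_factor_def top_characteristic_factor_def
    using X0(1,2) by blast
qed

subsection \<open>Transitive sets in the hyperspace\<close>

text \<open>The constraint at position 0 concerns the base point itself, so replacing
  \<open>U 0\<close> by its intersection with \<open>A\<close> amounts to choosing that point in
  \<open>A\<close>. As for systems, order 0 is included because it holds trivially.\<close>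

lemma delta_transitive_set_iff:
  assumes "closedin (top_of_set X) A"
  shows "delta_transitive_set X T A \<longleftrightarrow>
    (\<forall>d U. (\<forall>i\<le>d. openin (top_of_set X) (U i) \<and> U i \<inter> A \<noteq> {}) \<longrightarrow>
       (\<exists>n\<ge>1. \<exists>x\<in>A. \<forall>i\<le>d. (T ^^ (i * n)) x \<in> U i))" (is "_ \<longleftrightarrow> (\<forall>d U. ?hyp d U \<longrightarrow> ?goal d U)")
proof -
  have "A \<subseteq> X" using closedin_subset[OF assms] by simp
  have eq: "return_times X T d (U(0 := U 0 \<inter> A)) \<noteq> {} \<longleftrightarrow> ?goal d U" for d U
  proof -
    have "(x \<in> X \<and> (\<forall>i\<le>d. (T ^^ (i * n)) x \<in> (U(0 := U 0 \<inter> A)) i)) \<longleftrightarrow>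
        (x \<in> A \<and> (\<forall>i\<le>d. (T ^^ (i * n)) x \<in> U i))" for x n
    proof
      assume L: "x \<in> X \<and> (\<forall>i\<le>d. (T ^^ (i * n)) x \<in> (U(0 := U 0 \<inter> A)) i)"
      then have "(T ^^ (0 * n)) x \<in> (U(0 := U 0 \<inter> A)) 0" by blast
      then have "x \<in> U 0" "x \<in> A" by simp_all
      moreover have "(T ^^ (i * n)) x \<in> U i" if "i \<le> d" for i
        using L[THEN conjunct2, rule_format, OF that] by (cases "i = 0") auto
      ultimately show "x \<in> A \<and> (\<forall>i\<le>d. (T ^^ (i * n)) x \<in> U i)" by blast
    next
      assume R: "x \<in> A \<and> (\<forall>i\<le>d. (T ^^ (i * n)) x \<in> U i)"
      have "(T ^^ (i * n)) x \<in> (U(0 := U 0 \<inter> A)) i" if "i \<le> d" for i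
        using R[THEN conjunct2, rule_format, OF that] R by (cases "i = 0") auto
      then show "x \<in> X \<and> (\<forall>i\<le>d. (T ^^ (i * n)) x \<in> (U(0 := U 0 \<inter> A)) i)"
        using R \<open>A \<subseteq> X\<close> by blast
    qed
    then show ?thesis unfolding return_times_nonempty_iff Bex_def by simp
  qed
  have "?goal 0 U" if hyp: "?hyp 0 U" for U
  proof -
    obtain x where "x \<in> U 0 \<inter> A" using hyp by blast
    then show ?thesis by auto
  qed
  then have zero: "\<forall>U. ?hyp 0 U \<longrightarrow> ?goal 0 U" by blast
  from all_nat_iff_ge_1[of "\<lambda>d. \<forall>U. ?hyp d U \<longrightarrow> ?goal d U", OF zero]
  have "(\<forall>d U. ?hyp d U \<longrightarrow> ?goal d U) \<longleftrightarrow> (\<forall>d\<ge>1. \<forall>U. ?hyp d U \<longrightarrow> ?goal d U)" .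
  then show ?thesis
    unfolding delta_transitive_set_def delta_transitive_set_of_order_def eq
    using assms by (simp add: Ball_def)
qed

section \<open>Hit sets and the G_delta property\<close>

lemma infdist_less_obtains:
  assumes "infdist a B < e" "B \<noteq> {}"
  obtains b where "b \<in> B" "dist a b < e"
  using assms by (auto simp: infdist_notempty cINF_less_iff)

lemma hyperspace_memD:
  assumes "compact X" "A \<in> hyperspace X"
  shows "A \<subseteq> X" "A \<noteq> {}" "compact A" "bounded A" "closedin (top_of_set X) A"
  using assms closedin_compact[of X A] closedin_subset[of "top_of_set X" A]
  by (auto simp: hyperspace_def compact_imp_bounded)

lemma topspace_hausdorff:
  assumes "compact X"
  shows "topspace (hausdorff_topology X) = hyperspace X"
  unfolding hausdorff_topology_def by (rule Metric_space.topspace_mtopology[OF Metric_space_hausdorff[OF assms]])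

text \<open>If \<open>U\<close> contains all points of \<open>X\<close> within \<open>e\<close> of
  some \<open>a\<close> in \<open>A\<close>, then a set at Hausdorff distance less than
  \<open>e\<close> from \<open>A\<close> has a point that close to \<open>a\<close>, and so meets
  \<open>U\<close>.\<close>

lemma openin_hausdorff_hit:
  assumes "compact X" "openin (top_of_set X) U"
  shows "openin (hausdorff_topology X) {A \<in> hyperspace X. U \<inter> A \<noteq> {}}"
proof -
  interpret Metric_space "hyperspace X" hausdorff_dist by (rule Metric_space_hausdorff[OF assms(1)])
  have "\<exists>r>0. mball A r \<subseteq> {A \<in> hyperspace X. U \<inter> A \<noteq> {}}"
    if A: "A \<in> hyperspace X" "U \<inter> A \<noteq> {}" for A
  proof -
    obtain a where a: "a \<in> U" "a \<in> A" using A by blast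
    obtain e where e: "e > 0" "ball a e \<inter> X \<subseteq> U"
      using assms(2) a(1) openin_contains_ball[of X U] by blast
    have "U \<inter> B \<noteq> {}" if B: "B \<in> mball A e" for B
    proof -
      have BX: "B \<in> hyperspace X" "hausdorff_dist A B < e" using B by auto
      note hA = hyperspace_memD[OF assms(1) A(1)] and hB = hyperspace_memD[OF assms(1) BX(1)]
      have "infdist a B \<le> hausdorff_dist A B"
        using hausdorff_dist_less_eq_iff[of A B "hausdorff_dist A B"] hA hB a(2) by auto
      then have "infdist a B < e" using BX(2) by simp
      then obtain b where "b \<in> B" "dist a b < e" using hB(2) by (rule infdist_less_obtains)
      then show ?thesis using e(2) hB(1) by auto
    qed
    then show ?thesis using e(1) by (intro exI[of _ e]) auto
  qed
  then show ?thesis unfolding hausdorff_topology_def openin_mtopology by auto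
qed

text \<open>It suffices to test transitivity of a set on finite lists from a countable base. Each
  test is an implication between two open hit conditions, hence a union of a closed and an open set;
  closed sets are G_delta in a metrizable space, and there are countably many tests.\<close>

lemma gdelta_in_Delta_Trans:
  fixes X :: "'a::metric_space set"
  assumes "tds X T"
  shows "gdelta_in (hausdorff_topology X) (Delta_Trans X T)"
proof -
  have "compact X" using assms by (simp add: tds_def)
  then obtain \<B> where B: "countable \<B>" "\<forall>V\<in>\<B>. openin (top_of_set X) V"
    "\<forall>U x. openin (top_of_set X) U \<and> x \<in> U \<longrightarrow> (\<exists>V\<in>\<B>. x \<in> V \<and> V \<subseteq> U)"
    by (rule compact_countable_base)
  define hit where "hit U = {A \<in> hyperspace X. U \<inter> A \<noteq> {}}" for U
  have open_hit: "openin (hausdorff_topology X) (hit U)" if "openin (top_of_set X) U" for U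
    unfolding hit_def by (rule openin_hausdorff_hit[OF \<open>compact X\<close> that])
  have top: "topspace (hausdorff_topology X) = hyperspace X"
    by (rule topspace_hausdorff[OF \<open>compact X\<close>])
  have metr: "metrizable_space (hausdorff_topology X)"
    unfolding hausdorff_topology_def
    by (rule Metric_space.metrizable_space_mtopology[OF Metric_space_hausdorff[OF \<open>compact X\<close>]])
  \<comment> \<open>Here the first list entry constrains the point itself, so the exponent has
    \<open>i\<close> where the generic points above have \<open>Suc i\<close>.\<close>
  define R where "R Us = (\<Union>n\<in>{1..}. {x \<in> X. \<forall>i\<in>{..<length Us}. (T ^^ (i * n)) x \<in> Us ! i})" for Us
  \<comment> \<open>The implication "if \<open>A\<close> meets every entry of \<open>Us\<close>,
    then \<open>A\<close> meets \<open>R Us\<close>", written as a union. Intersecting with the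
    hyperspace keeps the premise inside it when the list is empty.\<close>
  define E where "E Us = (hyperspace X - (\<Inter>V\<in>set Us. hit V) \<inter> hyperspace X) \<union> hit (R Us)" for Us
  have "gdelta_in (hausdorff_topology X) (E Us)" if Us: "Us \<in> lists \<B>" for Us
  proof -
    have Us': "openin (top_of_set X) V" if "V \<in> set Us" for V
      using Us B(2) that by (auto simp: lists_eq_set)
    have "openin (top_of_set X) (R Us)"
      unfolding R_def
      by (intro openin_Union ballI) (auto intro!: openin_funpow_constraints assms Us'[OF nth_mem])
    then have "gdelta_in (hausdorff_topology X) (hit (R Us))"
      by (intro open_imp_gdelta_in open_hit)
    moreover have "openin (hausdorff_topology X) ((\<Inter>V\<in>set Us. hit V) \<inter> hyperspace X)"
    proof (cases "Us = []")
      case True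
      then show ?thesis using openin_topspace[of "hausdorff_topology X"] by (simp add: top)
    next
      case False
      have "openin (hausdorff_topology X) (\<Inter>V\<in>set Us. hit V)"
        using False Us' open_hit by (intro openin_Inter) auto
      then show ?thesis using openin_topspace[of "hausdorff_topology X"] by (metis openin_Int top)
    qed
    then have "gdelta_in (hausdorff_topology X) (hyperspace X - (\<Inter>V\<in>set Us. hit V) \<inter> hyperspace X)"
      by (metis closed_imp_gdelta_in closedin_diff closedin_topspace metr top)
    ultimately show ?thesis unfolding E_def by (intro gdelta_in_Un)
  qed
  then have "gdelta_in (hausdorff_topology X) (\<Inter>(E ` lists \<B>))"
    using B(1) by (intro gdelta_in_Inter) auto
  moreover have "\<Inter>(E ` lists \<B>) = Delta_Trans X T"
  proof (intro equalityI subsetI)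
    fix A assume A: "A \<in> \<Inter>(E ` lists \<B>)"
    \<comment> \<open>For the empty list the first part of the union is empty, so membership puts
      \<open>A\<close> in a hit set and thus in the hyperspace.\<close>
    then have "A \<in> E []" by auto
    then have hA: "A \<in> hyperspace X" by (auto simp: E_def hit_def)
    note hA' = hyperspace_memD[OF \<open>compact X\<close> hA]
    have "\<exists>n\<ge>1. \<exists>x\<in>A. \<forall>i\<le>d. (T ^^ (i * n)) x \<in> U i"
      if U: "\<forall>i\<le>d. openin (top_of_set X) (U i) \<and> U i \<inter> A \<noteq> {}" for d U
    proof -
      have "\<forall>i\<in>{..d}. \<exists>V. V \<in> \<B> \<and> V \<inter> A \<noteq> {} \<and> V \<subseteq> U i"
      proof
        fix i assume "i \<in> {..d}"
        then obtain y where "openin (top_of_set X) (U i)" "y \<in> U i" "y \<in> A" using U by blast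
        then obtain W where "W \<in> \<B>" "y \<in> W" "W \<subseteq> U i" using B(3) by blast
        then show "\<exists>V. V \<in> \<B> \<and> V \<inter> A \<noteq> {} \<and> V \<subseteq> U i" using \<open>y \<in> A\<close> by blast
      qed
      from bchoice[OF this] obtain V
        where V: "\<forall>i\<in>{..d}. V i \<in> \<B> \<and> V i \<inter> A \<noteq> {} \<and> V i \<subseteq> U i" ..
      define Us where "Us = map V [0..<Suc d]"
      have set_Us: "set Us = V ` {..d}" by (auto simp: Us_def image_iff simp del: upt_Suc)
      have "Us \<in> lists \<B>" using V by (auto simp: set_Us in_lists_conv_set)
      then have "A \<in> E Us" using A by auto
      moreover have "A \<in> (\<Inter>V\<in>set Us. hit V) \<inter> hyperspace X"
        using V hA by (auto simp: set_Us hit_def)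
      ultimately have "A \<in> hit (R Us)" by (auto simp: E_def)
      then obtain x n where x: "x \<in> A" "n \<ge> 1" "\<forall>i\<in>{..<length Us}. (T ^^ (i * n)) x \<in> Us ! i"
        by (auto simp: hit_def R_def)
      have "(T ^^ (i * n)) x \<in> U i" if "i \<le> d" for i
      proof -
        have "i < length Us" "Us ! i = V i"
          using that by (simp_all add: Us_def del: upt_Suc)
        then have "(T ^^ (i * n)) x \<in> V i" using x(3) by auto
        then show ?thesis using V that by blast
      qed
      then show ?thesis using x(1,2) by blast
    qed
    then show "A \<in> Delta_Trans X T"
      unfolding Delta_Trans_def using hA delta_transitive_set_iff[OF hA'(5), of T] by blast
  next
    fix A assume "A \<in> Delta_Trans X T"
    then have hA: "A \<in> hyperspace X" and dA: "delta_transitive_set X T A"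
      by (simp_all add: Delta_Trans_def)
    note hA' = hyperspace_memD[OF \<open>compact X\<close> hA]
    have "A \<in> E Us" if Us: "Us \<in> lists \<B>" for Us
    proof (cases "\<forall>V\<in>set Us. V \<inter> A \<noteq> {}")
      case False
      then show ?thesis using hA by (auto simp: E_def hit_def)
    next
      case True
      \<comment> \<open>Order \<open>length Us\<close> has one position more than the list; that
        position is filled with \<open>X\<close>, which also covers the empty list.\<close>
      define U where "U i = (if i < length Us then Us ! i else X)" for i
      have "X \<inter> A \<noteq> {}" using hA'(1,2) by blast
      moreover have "openin (top_of_set X) V" if "V \<in> set Us" for V
        using Us B(2) that by (auto simp: lists_eq_set)
      ultimately have "\<forall>i\<le>length Us. openin (top_of_set X) (U i) \<and> U i \<inter> A \<noteq> {}"
        using True by (simp add: U_def)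
      then obtain n x where n: "n \<ge> 1" "x \<in> A" "\<forall>i\<le>length Us. (T ^^ (i * n)) x \<in> U i"
        using dA[unfolded delta_transitive_set_iff[OF hA'(5)]] by blast
      have "(T ^^ (i * n)) x \<in> Us ! i" if "i < length Us" for i
        using n(3)[rule_format, of i] that by (simp add: U_def)
      then have "x \<in> R Us" using n(1,2) hA'(1) by (auto simp: R_def)
      then show ?thesis using n(2) hA by (auto simp: E_def hit_def)
    qed
    then show "A \<in> \<Inter>(E ` lists \<B>)" by blast
  qed
  ultimately show ?thesis by simp
qed

section \<open>Density of the transitive sets\<close>

text \<open>The closed sets meeting all of \<open>U 0\<close>, ..., \<open>U d\<close> form an open
  set of the hyperspace that contains \<open>X\<close>. By density it contains a transitive set
  \<open>A\<close>, and the return time for \<open>A\<close> is one for \<open>X\<close>.\<close>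

lemma Delta_Trans_dense_imp_delta_transitive:
  fixes X :: "'a::metric_space set"
  assumes "tds X T" "hausdorff_topology X closure_of Delta_Trans X T = hyperspace X"
  shows "delta_transitive X T"
proof -
  have X: "compact X" "X \<noteq> {}" using assms(1) by (simp_all add: tds_def)
  have "\<exists>n\<ge>1. \<exists>x\<in>X. \<forall>i\<le>d. (T ^^ (i * n)) x \<in> U i"
    if U: "\<forall>i\<le>d. openin (top_of_set X) (U i) \<and> U i \<noteq> {}" for d U
  proof -
    let ?W = "\<Inter>i\<in>{..d}. {A \<in> hyperspace X. U i \<inter> A \<noteq> {}}"
    have "openin (hausdorff_topology X) ?W"
      using U by (intro openin_Inter) (auto intro: openin_hausdorff_hit[OF X(1)])
    moreover have "X \<in> ?W"
    proof -
      have "U i \<subseteq> X" "U i \<noteq> {}" if "i \<le> d" for i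
        using U that openin_imp_subset by blast+
      then have "U i \<inter> X \<noteq> {}" if "i \<le> d" for i
        using that by (simp add: Int_absorb2)
      then show ?thesis using X(2) by (simp add: hyperspace_def)
    qed
    moreover have "X \<in> hausdorff_topology X closure_of Delta_Trans X T"
      using X(2) by (simp add: assms(2) hyperspace_def)
    ultimately obtain A where A: "A \<in> Delta_Trans X T" "A \<in> ?W"
      unfolding in_closure_of by meson
    have hA: "A \<in> hyperspace X" and dA: "delta_transitive_set X T A"
      using A(1) by (simp_all add: Delta_Trans_def)
    note hA' = hyperspace_memD[OF X(1) hA]
    have "\<forall>i\<le>d. openin (top_of_set X) (U i) \<and> U i \<inter> A \<noteq> {}" using A(2) U by blast
    then have "\<exists>n\<ge>1. \<exists>x\<in>A. \<forall>i\<le>d. (T ^^ (i * n)) x \<in> U i"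
      using dA[unfolded delta_transitive_set_iff[OF hA'(5)]] by blast
    then show ?thesis using hA'(1) by blast
  qed
  then show ?thesis unfolding delta_transitive_iff[OF assms(1)] by blast
qed

text \<open>Finite sets of generic points are transitive and approximate any closed set: take a
  finite net of the closed set and move each of its points slightly into the residual set.\<close>

lemma delta_transitive_imp_Delta_Trans_dense:
  fixes X :: "'a::metric_space set"
  assumes "tds X T" "delta_transitive X T"
  shows "hausdorff_topology X closure_of Delta_Trans X T = hyperspace X"
proof -
  have X: "compact X" "X \<noteq> {}" using assms(1) by (simp_all add: tds_def)
  obtain X0 where X0: "gdelta_in (top_of_set X) X0" "top_of_set X closure_of X0 = X"
    "\<forall>x\<in>X0. \<forall>d U. (\<forall>i\<in>{1..d}. openin (top_of_set X) (U i) \<and> U i \<noteq> {}) \<longrightarrow>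
       (\<exists>n\<ge>1. \<forall>i\<in>{1..d}. (T ^^ (i * n)) x \<in> U i)"
    by (rule delta_transitive_generic_points[OF assms])
  have X0X: "X0 \<subseteq> X" using gdelta_in_subset[OF X0(1)] by simp
  have fin: "D \<in> Delta_Trans X T" if D: "finite D" "D \<noteq> {}" "D \<subseteq> X0" for D
  proof -
    have cl: "closedin (top_of_set X) D"
      using D X0X by (intro closed_subset) (auto simp: finite_imp_closed)
    have "\<exists>n\<ge>1. \<exists>x\<in>D. \<forall>i\<le>d. (T ^^ (i * n)) x \<in> U i"
      if U: "\<forall>i\<le>d. openin (top_of_set X) (U i) \<and> U i \<inter> D \<noteq> {}" for d U
    proof -
      \<comment> \<open>One point suffices: being generic, any point of \<open>D\<close> in
        \<open>U 0\<close> visits all remaining targets along its own orbit.\<close>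
      obtain x where x: "x \<in> U 0" "x \<in> D" using U by blast
      have "\<forall>i\<in>{1..d}. openin (top_of_set X) (U i) \<and> U i \<noteq> {}" using U by auto
      then obtain n where n: "n \<ge> 1" "\<forall>i\<in>{1..d}. (T ^^ (i * n)) x \<in> U i"
        using X0(3) x(2) D(3) by blast
      have "(T ^^ (i * n)) x \<in> U i" if "i \<le> d" for i
        using n(2)[THEN bspec, of i] x(1) that by (cases "i = 0") auto
      then show ?thesis using n(1) x(2) by blast
    qed
    then have "delta_transitive_set X T D" unfolding delta_transitive_set_iff[OF cl] by blast
    then show ?thesis using cl D(2) by (simp add: Delta_Trans_def hyperspace_def)
  qed
  interpret Metric_space "hyperspace X" hausdorff_dist by (rule Metric_space_hausdorff[OF X(1)])
  have "\<exists>D\<in>Delta_Trans X T. D \<in> mball A r" if A: "A \<in> hyperspace X" and r: "r > 0" for A r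
  proof -
    note hA = hyperspace_memD[OF X(1) A]
    \<comment> \<open>The net and the displacement into \<open>X0\<close> cost \<open>e\<close>
      each. The resulting bound \<open>2 * e\<close> is half of \<open>r\<close>, which leaves room
      for a strict inequality.\<close>
    define e where "e = r / 4"
    have e: "e > 0" using r by (simp add: e_def)
    obtain F where F: "finite F" "F \<subseteq> A" "A \<subseteq> (\<Union>c\<in>F. ball c e)"
      using seq_compact_imp_totally_bounded[OF compact_imp_seq_compact[OF hA(3)], rule_format, OF e]
      by blast
    have "\<forall>c\<in>F. \<exists>y. y \<in> X0 \<and> dist c y < e"
    proof
      fix c assume "c \<in> F"
      then have "c \<in> top_of_set X closure_of X0" using F(2) hA(1) X0(2) by blast
      moreover have "openin (top_of_set X) (X \<inter> ball c e)" by (simp add: openin_open_Int)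
      moreover have "c \<in> X \<inter> ball c e" using \<open>c \<in> F\<close> F(2) hA(1) e by auto
      ultimately obtain y where "y \<in> X0" "y \<in> X \<inter> ball c e" unfolding in_closure_of by blast
      then show "\<exists>y. y \<in> X0 \<and> dist c y < e" by auto
    qed
    from bchoice[OF this] obtain g where g: "\<forall>c\<in>F. g c \<in> X0 \<and> dist c (g c) < e" ..
    have "F \<noteq> {}" using F(3) hA(2) by auto
    then have D: "g ` F \<in> Delta_Trans X T" using F(1) g by (intro fin) auto
    have near: "infdist a (g ` F) \<le> 2 * e" if a: "a \<in> A" for a
    proof -
      obtain c where c: "c \<in> F" "dist c a < e" using F(3) a by auto
      have "infdist a (g ` F) \<le> dist a (g c)" using c(1) by (simp add: infdist_le)
      also have "\<dots> \<le> dist c a + dist c (g c)" by (metis dist_commute dist_triangle)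
      also have "\<dots> \<le> 2 * e" using c g by fastforce
      finally show ?thesis .
    qed
    \<comment> \<open>The net was chosen inside \<open>A\<close>, so only the displacement counts in
      this direction.\<close>
    have near': "infdist b A \<le> 2 * e" if b: "b \<in> g ` F" for b
    proof -
      obtain c where c: "c \<in> F" "b = g c" using b by blast
      then have "infdist b A \<le> dist b c" using F(2) by (intro infdist_le) auto
      also have "\<dots> \<le> 2 * e" using c g e by (fastforce simp: dist_commute)
      finally show ?thesis .
    qed
    have "hausdorff_dist A (g ` F) \<le> 2 * e"
      using hausdorff_dist_less_eq_iff[of A "g ` F" "2 * e"] near near' hA(2,4) \<open>F \<noteq> {}\<close> F(1)
      by (simp add: finite_imp_bounded)
    then have "hausdorff_dist A (g ` F) < r" using r by (simp add: e_def)
    moreover have "g ` F \<in> hyperspace X" using D by (simp add: Delta_Trans_def)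
    ultimately show ?thesis using D A by auto
  qed
  then show ?thesis unfolding hausdorff_topology_def metric_closure_of by blast
qed

theorem theorem8p4:
  fixes X :: "'a::metric_space set" and T :: "'a \<Rightarrow> 'a"
  assumes "tds X T"
  shows "(Ind_ap X T = X \<times> X \<longleftrightarrow> delta_transitive X T) \<and>
         (delta_transitive X T \<longleftrightarrow> (\<forall>d\<ge>2. trivial_top_characteristic_factor d X T)) \<and>
         ((\<forall>d\<ge>2. trivial_top_characteristic_factor d X T) \<longleftrightarrow>
            gdelta_in (hausdorff_topology X) (Delta_Trans X T) \<and>
            hausdorff_topology X closure_of Delta_Trans X T = hyperspace X)"
proof -
  let ?Ind = "Ind_ap X T = X \<times> X"
  let ?Char = "\<forall>d\<ge>2. trivial_top_characteristic_factor d X T"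
  let ?Trans = "gdelta_in (hausdorff_topology X) (Delta_Trans X T) \<and>
            hausdorff_topology X closure_of Delta_Trans X T = hyperspace X"
  have "?Ind \<longleftrightarrow> delta_transitive X T"
    by (rule iffI[OF Ind_ap_imp_delta_transitive[OF assms] delta_transitive_imp_Ind_ap[OF assms]])
  moreover have "delta_transitive X T \<Longrightarrow> ?Char"
    by (intro allI impI delta_transitive_imp_trivial_characteristic_factor[OF assms])
  \<comment> \<open>Returning to independence closes the cycle through the first three
    conditions.\<close>
  moreover have "?Char \<Longrightarrow> ?Ind"
    by (rule trivial_characteristic_factor_imp_Ind_ap[OF assms])
  \<comment> \<open>The G_delta property holds in every system, so the last condition amounts to
    density.\<close>
  moreover have "delta_transitive X T \<longleftrightarrow> ?Trans"
    using gdelta_in_Delta_Trans[OF assms] Delta_Trans_dense_imp_delta_transitive[OF assms]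
      delta_transitive_imp_Delta_Trans_dense[OF assms] by (intro iffI conjI) simp_all
  ultimately show ?thesis by argo
qed

end
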